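(* Let $0<q<1$, let $N\ge1$ be an integer, and let $\alpha,\beta$ be the parameters of the little $q$-Jacobi weight $z^\alpha(qz;q)_\beta$. Then $$\mathrm{Pf}\left(([j]_q-[i]_q)\frac{(1-q)(q^{\alpha+2};q)_{i+j-1}}{(q^{\alpha+\beta+4};q)_{i+j-1}}\right)_{i,j=0}^{2N-1}=q^{\frac13N(N-1)(4N+1)+\alpha N(N-1)}\prod_{k=0}^{N-1}\frac{(q;q)_{2k+1}\,(q^{\alpha+2};q)_{2k}\,(q^{\beta+2};q)_{2k}}{(q^{\alpha+\beta+4};q)_{2k-2}\,(q^{\alpha+\beta+2k+2};q)_{2k}\,(q^{\alpha+\beta+2k+2};q)_{2k+2}}.$$
   Context: $\mathrm{Pf}(A_{i,j})_{i,j=0}^{2N-1}$ denotes the Pfaffian of the $2N\times2N$ skew-symmetric matrix $(A_{i,j})$, normalised so that for $N=1$ it equals $A_{0,1}$; diagonal entries are $0$. $[j]_q=\frac{1-q^j}{1-q}$. $(x;q)_\infty=\prod_{l\ge0}(1-xq^l)$ and $(x;q)_s=(x;q)_\infty/(xq^s;q)_\infty$; thus $(x;q)_n=\prod_{l=0}^{n-1}(1-xq^l)$ for integers $n\ge0$, and in the $k=0$ factor $(q^{\alpha+\beta+4};q)_{-2}=\frac{1}{(1-q^{\alpha+\beta+3})(1-q^{\alpha+\beta+2})}$. (Up to constants the entries are built from the moments of the little $q$-Jacobi weight with parameters $\alpha+1,\beta+1$.) *)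

theory Defs
  imports "HOL-Analysis.Analysis" "HOL-Combinatorics.Permutations"
begin

text \<open>
  Pfaffian of the \<open>2N \<times> 2N\<close> matrix \<open>(A i j)\<close>, \<open>0 \<le> i, j < 2N\<close>, meant for skew-symmetric \<open>A\<close>.
  The factor \<open>1 / (2^N N!)\<close> accounts for the permutations that describe the same perfect matching
  of the indices, so that \<open>pfaffian 1 A = A 0 1\<close>.
\<close>
definition pfaffian :: "nat \<Rightarrow> (nat \<Rightarrow> nat \<Rightarrow> 'a::field_char_0) \<Rightarrow> 'a" where
  "pfaffian N A =
     (\<Sum>p | p permutes {..<2 * N}. of_int (sign p) * (\<Prod>i<N. A (p (2 * i)) (p (2 * i + 1))))
       / (2 ^ N * fact N)"

definition q_bracket :: "real \<Rightarrow> nat \<Rightarrow> real" where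
  "q_bracket q j = (1 - q ^ j) / (1 - q)"

definition q_poch_inf :: "real \<Rightarrow> real \<Rightarrow> real" where
  "q_poch_inf x q = (\<Prod>l. 1 - x * q ^ l)"

text \<open>
  The index \<open>s\<close> is an arbitrary real number, in particular it may be a negative integer. The
  quotient is meaningful for \<open>0 < q < 1\<close> as long as \<open>x q^(s+l) \<noteq> 1\<close> for all \<open>l \<ge> 0\<close>.
\<close>
definition q_poch :: "real \<Rightarrow> real \<Rightarrow> real \<Rightarrow> real" where
  "q_poch x q s = q_poch_inf x q / q_poch_inf (x * q powr s) q"

end

theory Submission
  imports Defs
begin

text \<open>
  Put \<open>a = q^(\<alpha>+1)\<close>, \<open>b = q^(\<beta>+1)\<close> and let \<open>m n = (a;q)_n / (ab;q)_n\<close> be the moments of the little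
  \<open>q\<close>-Jacobi weight with parameters \<open>\<alpha>\<close>, \<open>\<beta>\<close> (not \<open>\<alpha> + 1\<close>, \<open>\<beta> + 1\<close>). Up to a constant the
  \<open>(i, j)\<close> entry is \<open>r j * m (i + j) + s j * m (i + j + 1)\<close>, that is, \<open>\<langle>z^i, D z^j\<rangle>\<close> for an operator \<open>D\<close> that is
  skew-adjoint for this weight and raises degrees by one. In the basis of monic little \<open>q\<close>-Jacobi
  polynomials the matrix is therefore skew tridiagonal, so its Pfaffian is the product of the entries
  at \<open>(2k, 2k+1)\<close>, each up to sign a leading coefficient of \<open>D\<close> times a squared norm. The base change is
  unitriangular and does not affect the Pfaffian.
\<close>

section \<open>Pfaffians\<close>

lemma prod_lessThan_double:
  fixes f :: "nat \<Rightarrow> 'a::comm_monoid_mult"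
  shows "(\<Prod>j<2 * N. f j) = (\<Prod>i<N. f (2 * i) * f (2 * i + 1))"
  by (induction N) (auto simp: ac_simps)

section \<open>Determinants written as signed sums over permutations\<close>

lemma sign_comp_transpose:
  assumes "p permutes S" "finite S" "a \<noteq> b"
  shows "sign (p \<circ> Transposition.transpose a b) = - sign p"
  using assms
  by (subst sign_compose) (auto simp: sign_swap_id permutation_swap_id intro: permutation_permutes[THEN iffD2])

text \<open>A determinant with two equal columns vanishes: composing with the transposition of the
  two positions keeps each product and flips its sign.\<close>

lemma sum_sign_prod_eq_0_if_not_inj:
  fixes L :: "nat \<Rightarrow> 'b \<Rightarrow> 'a::field_char_0"
  assumes "\<not> inj_on c {..<n}"
  shows "(\<Sum>p | p permutes {..<n}. of_int (sign p) * (\<Prod>j<n. L (p j) (c j))) = 0"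
proof -
  from assms obtain a b where ab: "a < n" "b < n" "a \<noteq> b" "c a = c b"
    by (auto simp: inj_on_def)
  define t where "t = Transposition.transpose a b"
  let ?F = "\<lambda>p. of_int (sign p) * (\<Prod>j<n. L (p j) (c j)) :: 'a"
  have t: "t permutes {..<n}"
    unfolding t_def using ab by (intro permutes_swap_id) auto
  have ct: "c (t j) = c j" for j
    using ab by (auto simp: t_def Transposition.transpose_def)
  have "?F (p \<circ> t) = - ?F p" if p: "p permutes {..<n}" for p
  proof -
    have "(\<Prod>j<n. L (p (t j)) (c j)) = (\<Prod>j<n. L (p (t j)) (c (t j)))"
      by (simp add: ct)
    also have "\<dots> = (\<Prod>j<n. L (p j) (c j))"
      using prod.permute[OF t, of "\<lambda>j. L (p j) (c j)"] by (simp add: o_def)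
    finally show ?thesis
      using sign_comp_transpose[OF p _ ab(3)] by (simp add: t_def)
  qed
  then have "sum ?F {p. p permutes {..<n}} = - sum ?F {p. p permutes {..<n}}"
    using sum_permutations_compose_right[OF t, of ?F] by (simp add: sum_negf)
  then show ?thesis by simp
qed

text \<open>Permuting the columns of a determinant: substitute \<open>p \<circ> c\<close> for
  \<open>p\<close>.\<close>

lemma sum_sign_prod_permuted:
  fixes L :: "nat \<Rightarrow> nat \<Rightarrow> 'a::field_char_0"
  assumes c: "c permutes {..<n}"
  shows "(\<Sum>p | p permutes {..<n}. of_int (sign p) * (\<Prod>j<n. L (p j) (c j)))
       = of_int (sign c) * (\<Sum>p | p permutes {..<n}. of_int (sign p) * (\<Prod>j<n. L (p j) j))"
proof -
  let ?F = "\<lambda>p. of_int (sign p) * (\<Prod>j<n. L (p j) (c j)) :: 'a"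
  have "?F (p \<circ> c) = of_int (sign c) * (of_int (sign p) * (\<Prod>j<n. L (p j) j))"
    if p: "p permutes {..<n}" for p
  proof -
    have "(\<Prod>j<n. L (p (c j)) (c j)) = (\<Prod>j<n. L (p j) j)"
      using prod.permute[OF c, of "\<lambda>j. L (p j) j"] by (simp add: o_def)
    moreover have "sign (p \<circ> c) = sign p * sign c"
      using p c by (intro sign_compose) (auto simp: permutation_permutes)
    ultimately show ?thesis by simp
  qed
  then show ?thesis
    using sum_permutations_compose_right[OF c, of ?F] by (simp add: sum_distrib_left)
qed

text \<open>Every permutation other than \<open>id\<close> sends some \<open>j\<close> to a smaller
  index and so meets a zero above the diagonal.\<close>

lemma sum_sign_prod_unitriangular:
  fixes L :: "nat \<Rightarrow> nat \<Rightarrow> 'a::field_char_0"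
  assumes "\<And>i j. i < j \<Longrightarrow> L i j = 0" "\<And>i. L i i = 1"
  shows "(\<Sum>p | p permutes {..<n}. of_int (sign p) * (\<Prod>j<n. L (p j) j)) = 1"
proof -
  have "(\<Sum>p | p permutes {..<n}. of_int (sign p) * (\<Prod>j<n. L (p j) j))
      = (\<Sum>p\<in>{id}. of_int (sign p) * (\<Prod>j<n. L (p j) j))"
  proof (rule sum.mono_neutral_right)
    show "\<forall>p\<in>{p. p permutes {..<n}} - {id}. of_int (sign p) * (\<Prod>j<n. L (p j) j) = 0"
    proof
      fix p assume "p \<in> {p. p permutes {..<n}} - {id}"
      then have p: "p permutes {..<n}" "p \<noteq> id" by auto
      obtain j where "j < n" "p j < j"
        using permutes_natset_ge[OF p(1)] p(2) by (meson lessThan_iff linorder_not_le)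
      then show "of_int (sign p) * (\<Prod>j<n. L (p j) j) = 0"
        using assms(1) by (auto intro!: prod_zero bexI[of _ j])
    qed
  qed (auto simp: finite_permutations permutes_id)
  then show ?thesis using assms(2) by simp
qed

section \<open>Pfaffians under the congruence B A B^T\<close>

definition interleave :: "(nat \<Rightarrow> 'a \<times> 'a) \<Rightarrow> nat \<Rightarrow> 'a" where
  "interleave g j = (if even j then fst (g (j div 2)) else snd (g (j div 2)))"

lemma interleave_simps [simp]:
  "interleave g (2 * i) = fst (g i)" "interleave g (Suc (2 * i)) = snd (g i)"
  by (auto simp: interleave_def)

lemma interleave_less:
  assumes "g \<in> {..<N} \<rightarrow>\<^sub>E {..<2 * N} \<times> {..<2 * N}" "j < 2 * N"
  shows "interleave g j < 2 * N"
proof -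
  have "g (j div 2) \<in> {..<2 * N} \<times> {..<2 * N}"
    using assms by (intro PiE_mem[OF assms(1)]) auto
  then show ?thesis by (auto simp: interleave_def)
qed

text \<open>Pf(B A B^T) = det B * Pf A. Multiplying out the product of double sums gives one term
  for each choice \<open>g\<close> of N index pairs. Its signed sum over \<open>p\<close> is the
  determinant of \<open>B\<close> with columns selected by \<open>interleave g\<close>, so only
  those \<open>g\<close> survive that list every index once, and these contribute
  \<open>sign c * det B\<close>.\<close>

lemma pfaffian_congruence:
  fixes A B :: "nat \<Rightarrow> nat \<Rightarrow> 'a::field_char_0"
  shows "pfaffian N (\<lambda>i j. \<Sum>(a, b)\<in>{..<2 * N} \<times> {..<2 * N}. B i a * A a b * B j b)
       = (\<Sum>p | p permutes {..<2 * N}. of_int (sign p) * (\<Prod>j<2 * N. B (p j) j)) * pfaffian N A"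
proof -
  let ?n = "2 * N"
  let ?P = "{p. p permutes {..<?n}}"
  let ?G = "{..<N} \<rightarrow>\<^sub>E {..<?n} \<times> {..<?n}"
  let ?I = "{g \<in> ?G. inj_on (interleave g) {..<?n}}"
  let ?D = "\<Sum>p | p permutes {..<?n}. of_int (sign p) * (\<Prod>j<?n. B (p j) j)"
  let ?A = "\<lambda>c. \<Prod>i<N. A (c (2 * i)) (c (2 * i + 1))"
  have fin: "finite ?G" by (intro finite_PiE) auto
  have expand: "(\<Prod>i<N. \<Sum>(a, b)\<in>{..<?n} \<times> {..<?n}. B (p (2 * i)) a * A a b * B (p (2 * i + 1)) b)
      = (\<Sum>g\<in>?G. ?A (interleave g) * (\<Prod>j<?n. B (p j) (interleave g j)))" for p
    by (simp only: prod_sum_PiE[OF finite_lessThan finite_cartesian_product[OF finite_lessThan finite_lessThan]]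
        prod_lessThan_double prod.distrib[symmetric] case_prod_unfold interleave_simps
        Suc_eq_plus1[symmetric])
       (simp only: mult.assoc mult.commute mult.left_commute)
  have "(\<Sum>p\<in>?P. of_int (sign p) *
        (\<Prod>i<N. \<Sum>(a, b)\<in>{..<?n} \<times> {..<?n}. B (p (2 * i)) a * A a b * B (p (2 * i + 1)) b))
      = (\<Sum>p\<in>?P. \<Sum>g\<in>?G. ?A (interleave g) * (of_int (sign p) * (\<Prod>j<?n. B (p j) (interleave g j))))"
    unfolding expand sum_distrib_left by (intro sum.cong refl) (simp only: ac_simps)
  also have "\<dots> = (\<Sum>g\<in>?G. ?A (interleave g) *
        (\<Sum>p\<in>?P. of_int (sign p) * (\<Prod>j<?n. B (p j) (interleave g j))))"
    by (subst sum.swap) (simp add: sum_distrib_left)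
  also have "\<dots> = (\<Sum>g\<in>?I. ?A (interleave g) *
        (\<Sum>p\<in>?P. of_int (sign p) * (\<Prod>j<?n. B (p j) (interleave g j))))"
    using fin by (intro sum.mono_neutral_right) (auto simp: sum_sign_prod_eq_0_if_not_inj)
  \<comment> \<open>The injective sequences of length 2N are exactly the permutations, once extended
    by the identity outside the range.\<close>
  also have "\<dots> = (\<Sum>c\<in>?P. ?A c * (of_int (sign c) * ?D))"
  proof (rule sum.reindex_bij_witness[of _
        "\<lambda>c. restrict (\<lambda>i. (c (2 * i), c (2 * i + 1))) {..<N}"
        "\<lambda>g j. if j < ?n then interleave g j else j"])
    fix g assume g: "g \<in> ?I"
    then have gE: "g \<in> ?G" and inj: "inj_on (interleave g) {..<?n}" by auto
    let ?c = "\<lambda>j. if j < ?n then interleave g j else j"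
    have inj': "inj_on ?c {..<?n}" using inj by (auto simp: inj_on_def)
    moreover have "?c ` {..<?n} \<subseteq> {..<?n}" using interleave_less[OF gE] by auto
    ultimately have "bij_betw ?c {..<?n} {..<?n}"
      unfolding bij_betw_def using endo_inj_surj[of "{..<?n}" ?c] by blast
    then have c: "?c permutes {..<?n}" by (rule bij_imp_permutes) simp
    then show "?c \<in> ?P" by simp
    show "restrict (\<lambda>i. (?c (2 * i), ?c (2 * i + 1))) {..<N} = g"
      using gE by (intro ext) (auto simp: PiE_iff extensional_def)
    have "(\<Sum>p\<in>?P. of_int (sign p) * (\<Prod>j<?n. B (p j) (interleave g j)))
        = (\<Sum>p\<in>?P. of_int (sign p) * (\<Prod>j<?n. B (p j) (?c j)))"
      by (intro sum.cong prod.cong arg_cong2[of _ _ _ _ "(*)"] refl) auto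
    also have "\<dots> = of_int (sign ?c) * ?D" by (rule sum_sign_prod_permuted[OF c])
    finally show "?A ?c * (of_int (sign ?c) * ?D) = ?A (interleave g) *
        (\<Sum>p\<in>?P. of_int (sign p) * (\<Prod>j<?n. B (p j) (interleave g j)))"
      by (auto intro!: prod.cong)
  next
    fix c assume "c \<in> ?P"
    then have c: "c permutes {..<?n}" by simp
    let ?g = "restrict (\<lambda>i. (c (2 * i), c (2 * i + 1))) {..<N}"
    have il: "interleave ?g j = c j" if "j < ?n" for j
    proof -
      have "j div 2 < N" using that by auto
      then show ?thesis by (cases "even j") (auto simp: interleave_def)
    qed
    show "(\<lambda>j. if j < ?n then interleave ?g j else j) = c"
      using il permutes_not_in[OF c] by auto
    have "inj_on c {..<?n}" using permutes_inj_on[OF c] .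
    then have "inj_on (interleave ?g) {..<?n}" using il by (auto simp: inj_on_def)
    moreover have "c j < ?n" if "j < ?n" for j using permutes_in_image[OF c, of j] that by simp
    ultimately show "?g \<in> ?I" by auto
  qed
  also have "\<dots> = ?D * (\<Sum>c\<in>?P. of_int (sign c) * ?A c)"
    by (simp add: sum_distrib_left ac_simps)
  finally show ?thesis by (simp add: pfaffian_def)
qed

section \<open>Pfaffians of skew tridiagonal matrices\<close>

definition pf_term :: "nat \<Rightarrow> (nat \<Rightarrow> nat \<Rightarrow> 'a::field_char_0) \<Rightarrow> (nat \<Rightarrow> nat) \<Rightarrow> 'a" where
  "pf_term N T p = of_int (sign p) * (\<Prod>i<N. T (p (2 * i)) (p (2 * i + 1)))"

text \<open>The sign of the transposition cancels against the sign from skew symmetry in the single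
  affected factor.\<close>

lemma pf_term_comp_swap_within_block:
  assumes skew: "\<And>i j. T i j = - T j i"
    and p: "p permutes {..<2 * N}" and "i < N"
  shows "pf_term N T (p \<circ> Transposition.transpose (2 * i) (2 * i + 1)) = pf_term N T p"
proof -
  let ?t = "Transposition.transpose (2 * i) (2 * i + 1)"
  have "(\<Prod>k<N. T (p (?t (2 * k))) (p (?t (2 * k + 1))))
      = (\<Prod>k<N. (if k = i then - 1 else 1) * T (p (2 * k)) (p (2 * k + 1)))"
  proof (rule prod.cong[OF refl])
    fix k
    have "?t (2 * k) = 2 * k \<and> ?t (2 * k + 1) = 2 * k + 1" if "k \<noteq> i"
    proof -
      have "2 * k \<noteq> 2 * i + 1" "2 * k + 1 \<noteq> 2 * i" by presburger+
      then show ?thesis using that by (auto simp: Transposition.transpose_def)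
    qed
    then show "T (p (?t (2 * k))) (p (?t (2 * k + 1)))
        = (if k = i then - 1 else 1) * T (p (2 * k)) (p (2 * k + 1))"
      using skew[of "p (2 * i)" "p (2 * i + 1)"] by auto
  qed
  also have "\<dots> = - (\<Prod>k<N. T (p (2 * k)) (p (2 * k + 1)))"
    using \<open>i < N\<close> by (simp add: prod.distrib prod.delta)
  finally show ?thesis
    using sign_comp_transpose[OF p, of "2 * i" "2 * i + 1"] by (simp add: pf_term_def)
qed

text \<open>Exchanging two different blocks takes two transpositions, so the sign is kept and the
  factors are merely reordered.\<close>

lemma pf_term_comp_swap_blocks:
  assumes p: "p permutes {..<2 * N}" and "i < N" "k < N"
  shows "pf_term N T (p \<circ> (Transposition.transpose (2 * i) (2 * k) \<circ>
           Transposition.transpose (2 * i + 1) (2 * k + 1))) = pf_term N T p"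
proof (cases "i = k")
  case False
  let ?t = "Transposition.transpose (2 * i) (2 * k)"
  let ?u = "Transposition.transpose (2 * i + 1) (2 * k + 1)"
  let ?s = "Transposition.transpose i k"
  have tu: "?t (?u (2 * m)) = 2 * ?s m" "?t (?u (2 * m + 1)) = 2 * ?s m + 1" for m
  proof -
    have "2 * m \<noteq> 2 * i + 1" "2 * m \<noteq> 2 * k + 1"
      "2 * i + 1 \<noteq> 2 * k" "2 * k + 1 \<noteq> 2 * i" "2 * m + 1 \<noteq> 2 * k" "2 * m + 1 \<noteq> 2 * i"
      by presburger+
    then show "?t (?u (2 * m)) = 2 * ?s m" "?t (?u (2 * m + 1)) = 2 * ?s m + 1"
      by (auto simp: Transposition.transpose_def)
  qed
  have s: "?s permutes {..<N}" using assms by (intro permutes_swap_id) auto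
  have "(\<Prod>m<N. T (p (?t (?u (2 * m)))) (p (?t (?u (2 * m + 1)))))
      = (\<Prod>m<N. T (p (2 * m)) (p (2 * m + 1)))"
    unfolding tu using prod.permute[OF s, of "\<lambda>m. T (p (2 * m)) (p (2 * m + 1))"]
    by (simp add: o_def)
  moreover have "p \<circ> ?t permutes {..<2 * N}"
    using assms by (intro permutes_compose[OF _ p] permutes_swap_id) auto
  then have "sign (p \<circ> ?t \<circ> ?u) = sign p"
    using sign_comp_transpose[of "p \<circ> ?t" "{..<2 * N}" "2 * i + 1" "2 * k + 1"]
      sign_comp_transpose[OF p, of "2 * i" "2 * k"] False by simp
  ultimately show ?thesis by (simp add: pf_term_def o_assoc)
qed simp

text \<open>The last block is exchanged with the block of \<open>b\<close>; a swap inside that block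
  follows if \<open>b\<close> is its even element.\<close>

lemma obtain_block_symmetry:
  assumes skew: "\<And>i j. T i j = - T j i" and "b < 2 * Suc N"
  obtains \<sigma> where "\<sigma> permutes {..<2 * Suc N}" "\<sigma> (2 * N + 1) = b"
    "\<And>p. p permutes {..<2 * Suc N} \<Longrightarrow> pf_term (Suc N) T (p \<circ> \<sigma>) = pf_term (Suc N) T p"
proof -
  define i where "i = b div 2"
  have i: "i < Suc N" using assms(2) by (auto simp: i_def)
  define s where "s = Transposition.transpose (2 * i) (2 * N) \<circ>
           Transposition.transpose (2 * i + 1) (2 * N + 1)"
  have sp: "s permutes {..<2 * Suc N}"
    unfolding s_def using i by (intro permutes_compose permutes_swap_id) auto
  have inv: "pf_term (Suc N) T (p \<circ> s) = pf_term (Suc N) T p" if "p permutes {..<2 * Suc N}" for p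
    unfolding s_def using i that by (intro pf_term_comp_swap_blocks) auto
  have s: "s (2 * N + 1) = 2 * i + 1"
  proof -
    have "2 * i + 1 \<noteq> 2 * N" by presburger
    then show ?thesis by (auto simp: s_def Transposition.transpose_def)
  qed
  show ?thesis
  proof (cases "even b")
    case False
    then have "s (2 * N + 1) = b" using s by (simp add: i_def)
    then show ?thesis using that sp inv by blast
  next
    case True
    let ?t = "Transposition.transpose (2 * i) (2 * i + 1)"
    have t: "?t permutes {..<2 * Suc N}" using i by (intro permutes_swap_id) auto
    show ?thesis
    proof (rule that[of "?t \<circ> s"])
      show "?t \<circ> s permutes {..<2 * Suc N}" by (rule permutes_compose[OF sp t])
      show "(?t \<circ> s) (2 * N + 1) = b" using True by (simp add: s[simplified] i_def)
      show "pf_term (Suc N) T (p \<circ> (?t \<circ> s)) = pf_term (Suc N) T p"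
        if "p permutes {..<2 * Suc N}" for p
        using inv[OF permutes_compose[OF t that]]
          pf_term_comp_swap_within_block[OF skew that i] by (simp add: o_assoc)
    qed
  qed
qed

text \<open>
  The symmetries of the set of blocks \<open>{2i, 2i+1}\<close> act transitively on positions, so each of the
  \<open>2N + 2\<close> possible positions of the largest index contributes the same amount to the sum.
\<close>
lemma sum_pf_term_tridiagonal_Suc:
  fixes T :: "nat \<Rightarrow> nat \<Rightarrow> 'a::field_char_0"
  assumes skew: "\<And>i j. T i j = - T j i"
    and last: "\<And>i. i < 2 * N \<Longrightarrow> T i (2 * N + 1) = 0"
  shows "(\<Sum>p | p permutes {..<2 * Suc N}. pf_term (Suc N) T p)
       = of_nat (2 * Suc N) * T (2 * N) (2 * N + 1) * (\<Sum>p | p permutes {..<2 * N}. pf_term N T p)"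
proof -
  let ?a = "2 * N + 1"
  let ?P = "{p. p permutes {..<2 * Suc N}}"
  \<comment> \<open>The permutations are grouped by the position \<open>b\<close> with
    \<open>p b = ?a\<close>.\<close>
  let ?Q = "\<lambda>b. {p \<in> ?P. inv p ?a = b}"
  have Q: "sum (pf_term (Suc N) T) (?Q b) = sum (pf_term (Suc N) T) (?Q ?a)"
    if b: "b < 2 * Suc N" for b
  proof -
    obtain \<sigma> where \<sigma>: "\<sigma> permutes {..<2 * Suc N}" "\<sigma> ?a = b"
      "\<And>p. p permutes {..<2 * Suc N} \<Longrightarrow> pf_term (Suc N) T (p \<circ> \<sigma>) = pf_term (Suc N) T p"
      by (rule obtain_block_symmetry[of T b N, OF skew b]) (rule that)
    show ?thesis
    proof (rule sum.reindex_bij_witness[of _ "\<lambda>p. p \<circ> inv \<sigma>" "\<lambda>p. p \<circ> \<sigma>"])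
      fix p assume p: "p \<in> ?Q b"
      then have pp: "p permutes {..<2 * Suc N}" by simp
      have "p b = ?a" using p permutes_inverses(1)[OF pp] by auto
      then have "inv (p \<circ> \<sigma>) ?a = ?a"
        using permutes_inv_eq[OF permutes_compose[OF \<sigma>(1) pp], of ?a ?a] \<sigma>(2) by simp
      then show "p \<circ> \<sigma> \<in> ?Q ?a" using permutes_compose[OF \<sigma>(1) pp] by simp
      show "p \<circ> \<sigma> \<circ> inv \<sigma> = p"
        by (simp add: comp_assoc permutes_inv_o[OF \<sigma>(1)])
      show "pf_term (Suc N) T (p \<circ> \<sigma>) = pf_term (Suc N) T p" using \<sigma>(3)[OF pp] .
    next
      fix p assume p: "p \<in> ?Q ?a"
      then have pp: "p permutes {..<2 * Suc N}" by simp
      have \<sigma>i: "inv \<sigma> permutes {..<2 * Suc N}" by (rule permutes_inv[OF \<sigma>(1)])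
      have "p ?a = ?a" using p permutes_inv_eq[OF pp, of ?a ?a] by simp
      moreover have "inv \<sigma> b = ?a" using \<sigma>(2) permutes_inverses(2)[OF \<sigma>(1)] by auto
      ultimately have "inv (p \<circ> inv \<sigma>) ?a = b"
        using permutes_inv_eq[OF permutes_compose[OF \<sigma>i pp], of ?a b] by simp
      then show "p \<circ> inv \<sigma> \<in> ?Q b" using permutes_compose[OF \<sigma>i pp] by simp
      show "p \<circ> inv \<sigma> \<circ> \<sigma> = p"
        by (simp add: comp_assoc permutes_inv_o[OF \<sigma>(1)])
    qed
  qed
  have "sum (pf_term (Suc N) T) ?P = (\<Sum>b<2 * Suc N. sum (pf_term (Suc N) T) (?Q b))"
  proof (rule sum.group[symmetric])
    show "(\<lambda>p. inv p ?a) ` ?P \<subseteq> {..<2 * Suc N}"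
    proof safe
      fix p assume "p permutes {..<2 * Suc N}"
      then have "inv p permutes {..<2 * Suc N}" by (rule permutes_inv)
      from permutes_in_image[OF this, of ?a] show "inv p ?a < 2 * Suc N" by simp
    qed
  qed (auto simp: finite_permutations)
  also have "\<dots> = (\<Sum>b<2 * Suc N. sum (pf_term (Suc N) T) (?Q ?a))"
    by (intro sum.cong refl Q) auto
  also have "\<dots> = of_nat (2 * Suc N) * sum (pf_term (Suc N) T) (?Q ?a)" by simp
  also have "sum (pf_term (Suc N) T) (?Q ?a)
      = sum (pf_term (Suc N) T) {p. p permutes {..<2 * N}}"
  proof (rule sum.mono_neutral_right)
    show "{p. p permutes {..<2 * N}} \<subseteq> ?Q ?a"
    proof safe
      fix p assume p: "p permutes {..<2 * N}"
      then show pp: "p permutes {..<2 * Suc N}" by (rule permutes_subset) auto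
      have "p ?a = ?a" using permutes_not_in[OF p] by simp
      then show "inv p ?a = ?a" using permutes_inv_eq[OF pp] by blast
    qed
    \<comment> \<open>Here \<open>p\<close> fixes \<open>2 * N + 1\<close> but moves
      \<open>2 * N\<close>, necessarily to a smaller index, so its last factor is one of the zeros
      in the last column of \<open>T\<close>.\<close>
    show "\<forall>p\<in>?Q ?a - {p. p permutes {..<2 * N}}. pf_term (Suc N) T p = 0"
    proof
      fix p assume "p \<in> ?Q ?a - {p. p permutes {..<2 * N}}"
      then have p: "p permutes {..<2 * Suc N}" "inv p ?a = ?a" "\<not> p permutes {..<2 * N}"
        by auto
      have pa: "p ?a = ?a" using p(2) permutes_inverses(1)[OF p(1)] by metis
      have "p (2 * N) \<noteq> 2 * N"
      proof
        assume "p (2 * N) = 2 * N"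
        have "p permutes {..<2 * N}"
        proof (rule permutes_superset[OF p(1)])
          fix x assume "x \<in> {..<2 * Suc N} - {..<2 * N}"
          then have "x = 2 * N \<or> x = ?a" by auto
          then show "p x = x" using pa \<open>p (2 * N) = 2 * N\<close> by auto
        qed
        then show False using p(3) by simp
      qed
      moreover have "p (2 * N) \<noteq> ?a"
      proof
        assume "p (2 * N) = ?a"
        then have "p (2 * N) = p ?a" using pa by simp
        then show False using permutes_inj[OF p(1)] by (simp add: inj_eq)
      qed
      moreover have "p (2 * N) < 2 * Suc N" using permutes_in_image[OF p(1), of "2 * N"] by simp
      ultimately have "p (2 * N) < 2 * N" by arith
      then show "pf_term (Suc N) T p = 0"
        using last pa by (simp add: pf_term_def)
    qed
  qed (auto simp: finite_permutations)
  also have "\<dots> = T (2 * N) ?a * (\<Sum>p | p permutes {..<2 * N}. pf_term N T p)"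
    unfolding sum_distrib_left
  proof (rule sum.cong[OF refl])
    fix p assume "p \<in> {p. p permutes {..<2 * N}}"
    then have p: "p permutes {..<2 * N}" by simp
    have "p (2 * N) = 2 * N" "p ?a = ?a" using permutes_not_in[OF p] by auto
    then show "pf_term (Suc N) T p = T (2 * N) ?a * pf_term N T p"
      by (simp add: pf_term_def)
  qed
  finally show ?thesis by (simp only: mult.assoc)
qed

text \<open>The factors \<open>2 * Suc N\<close> collected by the recursion multiply to 2^N N!, the
  normalisation in \<open>pfaffian\<close>.\<close>

lemma pfaffian_tridiagonal:
  fixes T :: "nat \<Rightarrow> nat \<Rightarrow> 'a::field_char_0"
  assumes skew: "\<And>i j. T i j = - T j i"
    and tri: "\<And>i j. j < 2 * N \<Longrightarrow> i + 1 < j \<Longrightarrow> T i j = 0"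
  shows "pfaffian N T = (\<Prod>k<N. T (2 * k) (2 * k + 1))"
proof -
  have "(\<Sum>p | p permutes {..<2 * N}. pf_term N T p)
      = 2 ^ N * fact N * (\<Prod>k<N. T (2 * k) (2 * k + 1))"
    using tri
  proof (induction N)
    case 0
    then show ?case by (simp add: pf_term_def)
  next
    case (Suc N)
    have "(\<Sum>p | p permutes {..<2 * Suc N}. pf_term (Suc N) T p)
       = of_nat (2 * Suc N) * T (2 * N) (2 * N + 1) * (\<Sum>p | p permutes {..<2 * N}. pf_term N T p)"
      using Suc.prems by (intro sum_pf_term_tridiagonal_Suc skew) auto
    also have "(\<Sum>p | p permutes {..<2 * N}. pf_term N T p)
        = 2 ^ N * fact N * (\<Prod>k<N. T (2 * k) (2 * k + 1))"
      by (rule Suc.IH) (use Suc.prems in auto)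
    finally show ?case by (simp add: algebra_simps)
  qed
  then show ?thesis by (simp add: pfaffian_def pf_term_def)
qed

section \<open>Monic little q-Jacobi polynomials\<close>

definition fin_q_poch :: "real \<Rightarrow> real \<Rightarrow> nat \<Rightarrow> real" where
  "fin_q_poch x q n = (\<Prod>l<n. 1 - x * q ^ l)"

lemma fin_q_poch_0 [simp]: "fin_q_poch x q 0 = 1"
  by (simp add: fin_q_poch_def)

lemma fin_q_poch_Suc: "fin_q_poch x q (Suc n) = fin_q_poch x q n * (1 - x * q ^ n)"
  by (simp add: fin_q_poch_def)

lemma fin_q_poch_add:
  "fin_q_poch x q (m + n) = fin_q_poch x q m * fin_q_poch (x * q ^ m) q n"
  by (induction n) (simp_all add: fin_q_poch_Suc power_add mult.assoc)

lemma fin_q_poch_Suc_shift: "fin_q_poch x q (Suc n) = (1 - x) * fin_q_poch (x * q) q n"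
  using fin_q_poch_add[of x q 1 n] by (simp add: fin_q_poch_Suc)

lemma mult_power_less_1:
  fixes x q :: real
  assumes "0 < q" "q < 1" "0 < x" "x < 1"
  shows "x * q ^ n < 1"
proof -
  have "x * q ^ n \<le> x" using assms by (simp add: mult_left_le power_le_one)
  then show ?thesis using assms by linarith
qed

lemma fin_q_poch_pos:
  assumes "0 < q" "q < 1" "0 < x" "x < 1"
  shows "fin_q_poch x q n > 0"
  unfolding fin_q_poch_def using mult_power_less_1[OF assms] by (intro prod_pos) auto

section \<open>Moments and norms, and the parameter shift (a, b) to (a q, b q)\<close>

definition q_jacobi_moment :: "real \<Rightarrow> real \<Rightarrow> real \<Rightarrow> nat \<Rightarrow> real" where
  "q_jacobi_moment q a b n = fin_q_poch a q n / fin_q_poch (a * b) q n"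

text \<open>Squared norm of the monic polynomial of degree \<open>n\<close> for the weight of total
  mass 1. At \<open>n = 0\<close> the truncated \<open>n - 1\<close> is harmless, since the product
  it occurs in is empty.\<close>

definition q_jacobi_norm :: "real \<Rightarrow> real \<Rightarrow> real \<Rightarrow> nat \<Rightarrow> real" where
  "q_jacobi_norm q a b n = a ^ n * q ^ (n * (n - 1)) *
     fin_q_poch q q n * fin_q_poch a q n * fin_q_poch b q n /
     (fin_q_poch (a * b * q ^ (n - 1)) q n * fin_q_poch (a * b) q (2 * n))"

locale q_jacobi =
  fixes q a b :: real
  assumes q: "0 < q" "q < 1" and a: "0 < a" "a < 1" and b: "0 < b" "b < 1"
begin

lemma ab: "0 < a * b" "a * b < 1"
  using a b mult_strict_mono[of a 1 b 1] by auto

lemma factor_nz: "1 - a * q ^ n \<noteq> 0" "1 - b * q ^ n \<noteq> 0" "1 - a * b * q ^ n \<noteq> 0"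
    "1 - a \<noteq> 0" "1 - b \<noteq> 0" "1 - a * b \<noteq> 0" "1 - a * b * q \<noteq> 0"
  using mult_power_less_1[OF q a, of n] mult_power_less_1[OF q b, of n]
    mult_power_less_1[OF q ab, of n] mult_power_less_1[OF q ab, of 1] a b ab by auto

lemma moment_Suc:
  "q_jacobi_moment q a b (Suc n) =
     q_jacobi_moment q a b n * (1 - a * q ^ n) / (1 - a * b * q ^ n)"
  by (simp add: q_jacobi_moment_def fin_q_poch_Suc)

text \<open>The extra denominator completes (ab;q)_(n+2), from which two leading factors split off.
  This links the pairings for (a, b) to those for (a q, b q).\<close>

lemma moment_shift:
  "q_jacobi_moment q a b (Suc n) / (1 - a * b * q ^ Suc n) =
     (1 - a) / ((1 - a * b) * (1 - a * b * q)) * q_jacobi_moment q (a * q) (b * q) n"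
proof -
  have "fin_q_poch (a * b) q (Suc (Suc n)) =
      (1 - a * b) * (1 - a * b * q) * fin_q_poch (a * q * (b * q)) q n"
    by (simp add: fin_q_poch_Suc_shift ac_simps)
  then have "fin_q_poch (a * b) q (Suc n) * (1 - a * b * q ^ Suc n) =
      (1 - a * b) * (1 - a * b * q) * fin_q_poch (a * q * (b * q)) q n"
    by (simp only: fin_q_poch_Suc[of _ _ "Suc n"])
  then show ?thesis
    unfolding q_jacobi_moment_def by (simp add: fin_q_poch_Suc_shift[of a])
qed

lemma q_jacobi_shift: "q_jacobi q (a * q) (b * q)"
  using q a b mult_power_less_1[OF q a, of 1] mult_power_less_1[OF q b, of 1]
  by unfold_locales auto

text \<open>The constant is exactly what the raising operator contributes in the induction that
  constructs the orthogonal polynomials.\<close>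

lemma norm_Suc:
  "q_jacobi_norm q a b (Suc n) =
     a * (1 - a) * (1 - b) * q ^ n * (1 - q ^ Suc n) /
       ((1 - a * b * q ^ n) * (1 - a * b) * (1 - a * b * q)) * q_jacobi_norm q (a * q) (b * q) n"
proof -
  have e: "a ^ Suc n * q ^ (Suc n * (Suc n - 1)) = a * q ^ n * ((a * q) ^ n * q ^ (n * (n - 1)))"
    by (cases n) (simp_all add: power_mult_distrib power_add[symmetric] algebra_simps)
  have d: "fin_q_poch (a * b * q ^ (Suc n - 1)) q (Suc n)
      = (1 - a * b * q ^ n) * fin_q_poch (a * q * (b * q) * q ^ (n - 1)) q n"
    by (cases n) (simp_all add: fin_q_poch_Suc_shift ac_simps)
  have d2: "fin_q_poch (a * b) q (2 * Suc n)
      = (1 - a * b) * (1 - a * b * q) * fin_q_poch (a * q * (b * q)) q (2 * n)"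
    by (simp add: fin_q_poch_Suc_shift ac_simps)
  show ?thesis
    unfolding q_jacobi_norm_def e d d2 fin_q_poch_Suc_shift[of a] fin_q_poch_Suc_shift[of b]
      fin_q_poch_Suc[of q]
    by (simp only: power_Suc times_divide_times_eq mult.assoc mult.commute mult.left_commute)
qed

end

text \<open>
  The little \<open>q\<close>-Jacobi polynomial with parameters \<open>(a, b)\<close> is obtained from the one with parameters
  \<open>(a q, b q)\<close> by a raising operator (Rodrigues formula) of the form \<open>z^k \<mapsto> x k z^k + y k z^(k+1)\<close>,
  whose adjoint maps \<open>z^j\<close> to a multiple of \<open>(1 - q^j) z^(j-1)\<close>.
\<close>
lemma (in q_jacobi) orthogonal_polynomial_exists:
  "\<exists>f. f n = 1 \<and> (\<forall>k>n. f k = 0) \<and>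
     (\<forall>j<n. (\<Sum>k\<le>n. f k * q_jacobi_moment q a b (k + j)) = 0) \<and>
     (\<Sum>k\<le>n. f k * q_jacobi_moment q a b (k + n)) = q_jacobi_norm q a b n"
  using q_jacobi_axioms
proof (induction n arbitrary: a b)
  case 0
  then show ?case
    by (intro exI[of _ "\<lambda>k. if k = 0 then 1 else 0"])
       (simp add: q_jacobi_moment_def q_jacobi_norm_def)
next
  case (Suc n)
  interpret q_jacobi q a b by fact
  let ?m = "q_jacobi_moment q a b" and ?m' = "q_jacobi_moment q (a * q) (b * q)"
  from Suc.IH[OF q_jacobi_shift] obtain g where g: "g n = 1" "\<And>k. k > n \<Longrightarrow> g k = 0"
    "\<And>j. j < n \<Longrightarrow> (\<Sum>k\<le>n. g k * ?m' (k + j)) = 0"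
    "(\<Sum>k\<le>n. g k * ?m' (k + n)) = q_jacobi_norm q (a * q) (b * q) n"
    by blast
  \<comment> \<open>The constant \<open>c\<close> is chosen to give \<open>y n = 1\<close>, so that
    the raised polynomial is again monic.\<close>
  define c where "c = a * (1 - b) * q ^ n / (1 - a * b * q ^ n)"
  define y where "y k = c * (1 - a * b * q ^ k) / (a * (1 - b) * q ^ k)" for k
  \<comment> \<open>With this choice the pairing with \<open>z^j\<close> acquires the factor
    \<open>1 - q ^ j\<close>, hence vanishes at \<open>j = 0\<close>.\<close>
  define x where "x k = c - y k" for k
  define f where "f k = (case k of 0 \<Rightarrow> 0 | Suc i \<Rightarrow> g i * y i) + g k * x k" for k
  define K where "K = (1 - a) / ((1 - a * b) * (1 - a * b * q))"
  have yn: "y n = 1"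
    using factor_nz q a by (simp add: y_def c_def)
  have adj: "x k * ?m (k + j) + y k * ?m (Suc (k + j))
      = c * (1 - q ^ j) * (?m (k + j) / (1 - a * b * q ^ (k + j)))" for k j
  proof -
    have "x k * (1 - a * b * q ^ (k + j)) + y k * (1 - a * q ^ (k + j)) = c * (1 - q ^ j)"
    proof -
      have "y k * (a * (1 - b) * q ^ k) = c * (1 - a * b * q ^ k)"
        using factor_nz q a by (simp add: y_def)
      then have "y k * (a * (1 - b) * q ^ k) * q ^ j = c * (1 - a * b * q ^ k) * q ^ j"
        by simp
      then show ?thesis by (simp add: x_def power_add algebra_simps)
    qed
    moreover have "x k * ?m (k + j) + y k * ?m (Suc (k + j))
      = (x k * (1 - a * b * q ^ (k + j)) + y k * (1 - a * q ^ (k + j)))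
        * (?m (k + j) / (1 - a * b * q ^ (k + j)))"
      using factor_nz(3)[of "k + j"] by (simp add: moment_Suc field_simps)
    ultimately show ?thesis by simp
  qed
  have S: "(\<Sum>k\<le>Suc n. f k * ?m (k + j)) =
      c * (1 - q ^ j) * (\<Sum>k\<le>n. g k * (?m (k + j) / (1 - a * b * q ^ (k + j))))" for j
  proof -
    have "(\<Sum>k\<le>Suc n. f k * ?m (k + j)) =
        (\<Sum>k\<le>Suc n. (case k of 0 \<Rightarrow> 0 | Suc i \<Rightarrow> g i * y i) * ?m (k + j)) +
        (\<Sum>k\<le>Suc n. g k * x k * ?m (k + j))"
      by (simp only: f_def distrib_right sum.distrib)
    also have "(\<Sum>k\<le>Suc n. (case k of 0 \<Rightarrow> 0 | Suc i \<Rightarrow> g i * y i) * ?m (k + j))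
        = (\<Sum>k\<le>n. g k * y k * ?m (Suc (k + j)))"
      by (subst sum.atMost_Suc_shift) simp
    also have "(\<Sum>k\<le>Suc n. g k * x k * ?m (k + j)) = (\<Sum>k\<le>n. g k * x k * ?m (k + j))"
      by (simp add: g(2))
    also have "(\<Sum>k\<le>n. g k * y k * ?m (Suc (k + j))) + (\<Sum>k\<le>n. g k * x k * ?m (k + j))
        = (\<Sum>k\<le>n. g k * (x k * ?m (k + j) + y k * ?m (Suc (k + j))))"
      by (simp add: sum.distrib[symmetric] algebra_simps)
    also have "\<dots> = c * (1 - q ^ j) * (\<Sum>k\<le>n. g k * (?m (k + j) / (1 - a * b * q ^ (k + j))))"
      unfolding adj by (simp add: sum_distrib_left ac_simps)
    finally show ?thesis .
  qed
  \<comment> \<open>For positive exponents the sum becomes a pairing for (a q, b q) with exponent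
    one lower, where the induction hypothesis applies.\<close>
  have S_Suc: "(\<Sum>k\<le>Suc n. f k * ?m (k + Suc j)) =
      c * (1 - q ^ Suc j) * K * (\<Sum>k\<le>n. g k * ?m' (k + j))" for j
  proof -
    have "?m (k + Suc j) / (1 - a * b * q ^ (k + Suc j)) = K * ?m' (k + j)" for k
      using moment_shift[of "k + j"] by (simp add: K_def)
    then show ?thesis
      unfolding S by (simp only: sum_distrib_left mult.assoc mult.commute mult.left_commute)
  qed
  have "(\<Sum>k\<le>Suc n. f k * ?m (k + j)) = 0" if "j < Suc n" for j
  proof (cases j)
    case 0
    then show ?thesis using S[of 0] by simp
  next
    case (Suc i)
    then show ?thesis using S_Suc[of i] g(3)[of i] that by simp
  qed
  moreover have "(\<Sum>k\<le>Suc n. f k * ?m (k + Suc n)) = q_jacobi_norm q a b (Suc n)"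
    unfolding S_Suc g(4) norm_Suc by (simp add: c_def K_def ac_simps)
  moreover have "f (Suc n) = 1" "\<forall>k>Suc n. f k = 0"
    using g(1,2) yn by (auto simp: f_def split: nat.splits)
  ultimately show ?case by blast
qed

section \<open>Skew moment matrices of Hankel type\<close>

text \<open>
  With \<open>B\<close> the coefficient matrix of the monic orthogonal polynomials \<open>f n\<close> for the moments \<open>m\<close>,
  the matrix \<open>B A B^T\<close> represents the operator \<open>z^j \<mapsto> r j z^j + s j z^(j+1)\<close> in the orthogonal
  basis. The operator raises degrees by at most one, so skew symmetry makes \<open>B A B^T\<close> tridiagonal.
\<close>
lemma pfaffian_two_term_hankel:
  fixes A f :: "nat \<Rightarrow> nat \<Rightarrow> 'a::field_char_0" and m r s h :: "nat \<Rightarrow> 'a"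
  assumes skew: "\<And>i j. A i j = - A j i"
    and A: "\<And>i j. A i j = r j * m (i + j) + s j * m (Suc (i + j))"
    and monic: "\<And>n. f n n = 1" and deg: "\<And>n k. n < k \<Longrightarrow> f n k = 0"
    and orth: "\<And>n j. j < n \<Longrightarrow> (\<Sum>k\<le>n. f n k * m (k + j)) = 0"
    and norm: "\<And>n. (\<Sum>k\<le>n. f n k * m (k + n)) = h n"
  shows "pfaffian N A = (\<Prod>k<N. - s (2 * k) * h (2 * k + 1))"
proof -
  let ?n = "2 * N"
  define T where "T i j = (\<Sum>(a, b)\<in>{..<?n} \<times> {..<?n}. f i a * A a b * f j b)" for i j
  \<comment> \<open>\<open>U i y\<close> is the pairing of \<open>f i\<close> with
    \<open>z^y\<close>.\<close>
  define U where "U i y = (\<Sum>k\<le>i. f i k * m (k + y))" for i y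
  have T_skew: "T i j = - T j i" for i j
  proof -
    have "T i j = (\<Sum>(a, b)\<in>{..<?n} \<times> {..<?n}. f i b * A b a * f j a)"
      unfolding T_def by (rule sum.reindex_bij_witness[of _ prod.swap prod.swap]) auto
    also have "\<dots> = (\<Sum>(a, b)\<in>{..<?n} \<times> {..<?n}. - (f j a * A a b * f i b))"
    proof -
      have "f i b * A b a * f j a = - (f j a * A a b * f i b)" for a b
        by (subst skew[of b a]) (simp add: ac_simps)
      then show ?thesis by (simp only:)
    qed
    finally show ?thesis by (simp add: T_def sum_negf case_prod_unfold)
  qed
  have T_U: "T i j = (\<Sum>y\<le>j. f j y * (r y * U i y + s y * U i (Suc y)))"
    if "i < ?n" "j < ?n" for i j
  proof -
    have row: "(\<Sum>a<?n. f i a * A a y) = r y * U i y + s y * U i (Suc y)" for y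
    proof -
      have "(\<Sum>a<?n. f i a * A a y) = (\<Sum>a\<le>i. f i a * A a y)"
        using that deg by (intro sum.mono_neutral_right) auto
      also have "\<dots> = r y * U i y + s y * U i (Suc y)"
        unfolding A U_def by (simp add: sum_distrib_left sum.distrib algebra_simps)
      finally show ?thesis .
    qed
    have "T i j = (\<Sum>a<?n. \<Sum>y<?n. f i a * A a y * f j y)"
      by (simp add: T_def sum.cartesian_product)
    also have "\<dots> = (\<Sum>y<?n. f j y * (\<Sum>a<?n. f i a * A a y))"
      by (subst sum.swap) (simp add: sum_distrib_left ac_simps)
    also have "\<dots> = (\<Sum>y\<le>j. f j y * (\<Sum>a<?n. f i a * A a y))"
      using that deg by (intro sum.mono_neutral_right) auto
    finally show ?thesis by (simp only: row)
  qed
  have U_0: "U i y = 0" if "y < i" for i y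
    using orth[OF that] by (simp add: U_def)
  have tri: "T i j = 0" if "j < ?n" "i + 1 < j" for i j
  proof -
    \<comment> \<open>This pairs \<open>f j\<close> with the image of \<open>f i\<close>, whose
      degree is at most \<open>i + 1 < j\<close>.\<close>
    have "T j i = 0"
      using that by (auto simp: T_U U_0 intro!: sum.neutral)
    then show ?thesis using T_skew[of i j] by simp
  qed
  have diag: "T i (i + 1) = - s i * h (i + 1)" if "i + 1 < ?n" for i
  proof -
    have "T (i + 1) i = (\<Sum>y\<le>i. f i y * (r y * U (i + 1) y + s y * U (i + 1) (Suc y)))"
      using that by (intro T_U) auto
    \<comment> \<open>Only the leading term \<open>z^i\<close>, raised to \<open>s i\<close> times
      \<open>z^(i+1)\<close>, is not orthogonal to \<open>f (i + 1)\<close>.\<close>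
    also have "\<dots> = (\<Sum>y\<le>i. if y = i then s i * h (i + 1) else 0)"
      using norm[of "i + 1"] monic[of i]
      by (intro sum.cong refl) (auto simp: U_0 U_def[of "Suc i" "Suc i"])
    finally show ?thesis using T_skew[of i "i + 1"] by simp
  qed
  have "pfaffian N A = pfaffian N T"
    using pfaffian_congruence[of N f A] sum_sign_prod_unitriangular[of f ?n, OF deg monic]
    by (simp add: T_def[abs_def])
  also have "\<dots> = (\<Prod>k<N. T (2 * k) (2 * k + 1))"
    by (rule pfaffian_tridiagonal[OF T_skew tri])
  also have "\<dots> = (\<Prod>k<N. - s (2 * k) * h (2 * k + 1))"
    using diag by (intro prod.cong refl) auto
  finally show ?thesis .
qed

section \<open>Evaluation for the little q-Jacobi moments\<close>

context q_jacobi
begin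

text \<open>The left side is \<open>- s (2 * k)\<close> times the norm of degree
  \<open>2 * k + 1\<close>, with \<open>s\<close> the coefficient of the raising part in
  \<open>pfaffian_q_jacobi\<close>. Dividing (ab;q)_(2k) by its formal first two factors anticipates
  (abq^2;q)_(2k-2).\<close>

lemma norm_odd:
  "q_jacobi_norm q a b (Suc (2 * k)) * (1 - a * b * q ^ (4 * k)) / (a * q ^ (2 * k)) *
     ((1 - a * b) * (1 - a * b * q) / ((1 - a) * (1 - b)))
   = a ^ (2 * k) * q ^ (4 * k ^ 2) *
      (fin_q_poch q q (2 * k + 1) * fin_q_poch (a * q) q (2 * k) * fin_q_poch (b * q) q (2 * k) /
       (fin_q_poch (a * b) q (2 * k) / ((1 - a * b) * (1 - a * b * q)) *
        fin_q_poch (a * b * q ^ (2 * k)) q (2 * k) *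
        fin_q_poch (a * b * q ^ (2 * k)) q (2 * k + 2)))"
proof -
  have e: "a ^ Suc (2 * k) * q ^ (Suc (2 * k) * (Suc (2 * k) - 1))
      = (a * q ^ (2 * k)) * (a ^ (2 * k) * q ^ (4 * k ^ 2))"
    by (simp add: power_add[symmetric] power2_eq_square algebra_simps)
  have d: "fin_q_poch (a * b * q ^ (Suc (2 * k) - 1)) q (Suc (2 * k))
      = fin_q_poch (a * b * q ^ (2 * k)) q (2 * k) * (1 - a * b * q ^ (4 * k))"
    by (simp add: fin_q_poch_Suc mult.assoc power_add[symmetric])
  have d2: "fin_q_poch (a * b) q (2 * Suc (2 * k))
      = fin_q_poch (a * b) q (2 * k) * fin_q_poch (a * b * q ^ (2 * k)) q (2 * k + 2)"
    unfolding fin_q_poch_add[symmetric] by (simp add: numeral_eq_Suc)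
  define X where "X = a * q ^ (2 * k)"
  define Y where "Y = 1 - a * b * q ^ (4 * k)"
  have nz: "X \<noteq> 0" "Y \<noteq> 0" using a q factor_nz by (auto simp: X_def Y_def)
  define E where "E = a ^ (2 * k) * q ^ (4 * k ^ 2)"
  have cancel: "X * E * q1 * ((1 - a) * a1) * ((1 - b) * b1) / (d1 * Y * (d2 * d3)) * Y / X *
      ((1 - a * b) * (1 - a * b * q) / ((1 - a) * (1 - b)))
      = E * (q1 * a1 * b1 / (d2 / ((1 - a * b) * (1 - a * b * q)) * d1 * d3))"
    for q1 a1 b1 d1 d2 d3 :: real
    using nz factor_nz(4-7) by (simp add: ac_simps)
  show ?thesis
    unfolding q_jacobi_norm_def e d d2 fin_q_poch_Suc_shift[of a] fin_q_poch_Suc_shift[of b]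
      X_def[symmetric] Y_def[symmetric] E_def[symmetric]
    using cancel by simp
qed

lemma pfaffian_q_jacobi:
  "pfaffian N (\<lambda>i j. (q ^ i - q ^ j) * ((1 - a * b) * (1 - a * b * q) / (1 - a)) *
       (q_jacobi_moment q a b (i + j) / (1 - a * b * q ^ (i + j))))
   = (\<Prod>k<N. a ^ (2 * k) * q ^ (4 * k ^ 2) *
      (fin_q_poch q q (2 * k + 1) * fin_q_poch (a * q) q (2 * k) * fin_q_poch (b * q) q (2 * k) /
       (fin_q_poch (a * b) q (2 * k) / ((1 - a * b) * (1 - a * b * q)) *
        fin_q_poch (a * b * q ^ (2 * k)) q (2 * k) *
        fin_q_poch (a * b * q ^ (2 * k)) q (2 * k + 2))))"
    (is "pfaffian N ?A = _")
proof -
  let ?m = "q_jacobi_moment q a b"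
  define C where "C = (1 - a * b) * (1 - a * b * q) / (1 - a)"
  define c where "c = (1 - a * b) * (1 - a * b * q) / ((1 - a) * (1 - b))"
  \<comment> \<open>\<open>r\<close> and \<open>s\<close> solve \<open>r j * (1 - a * b * q ^ (i +
    j)) + s j * (1 - a * q ^ (i + j)) = C * (q ^ i - q ^ j)\<close> for all \<open>i\<close>.
    Comparing the coefficients of \<open>q ^ i\<close> gives r + s = -C q^j and ab r + a s = -C
    q^(-j).\<close>
  define r where "r j = c * (1 / (a * q ^ j) - q ^ j)" for j
  define s where "s j = c * (b * q ^ j - 1 / (a * q ^ j))" for j
  have C: "C = c * (1 - b)" using factor_nz by (simp add: C_def c_def)
  have two_term: "?A i j = r j * ?m (i + j) + s j * ?m (Suc (i + j))" for i j
  proof -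
    let ?d = "1 - a * b * q ^ (i + j)"
    have "r j * ?d + s j * (1 - a * q ^ (i + j))
        = c * ((1 / (a * q ^ j) - q ^ j) * ?d + (b * q ^ j - 1 / (a * q ^ j)) * (1 - a * q ^ (i + j)))"
      by (simp only: r_def s_def distrib_left mult.assoc)
    also have "(1 / (a * q ^ j) - q ^ j) * ?d + (b * q ^ j - 1 / (a * q ^ j)) * (1 - a * q ^ (i + j))
        = (1 - b) * (q ^ i - q ^ j)"
      using a q by (simp add: field_simps power_add)
    finally have eq: "(q ^ i - q ^ j) * C = r j * ?d + s j * (1 - a * q ^ (i + j))"
      by (simp add: C)
    define M where "M = ?m (i + j) / ?d"
    have "(q ^ i - q ^ j) * C * M = r j * (M * ?d) + s j * (M * (1 - a * q ^ (i + j)))"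
      unfolding eq by (simp only: distrib_right mult.assoc mult.commute[of M])
    moreover have "?m (i + j) = M * ?d" "?m (Suc (i + j)) = M * (1 - a * q ^ (i + j))"
      using factor_nz(3)[of "i + j"] by (simp_all add: M_def moment_Suc)
    ultimately have "(q ^ i - q ^ j) * C * M = r j * ?m (i + j) + s j * ?m (Suc (i + j))"
      by (simp only:)
    then show ?thesis unfolding C_def M_def .
  qed
  have "\<forall>n. \<exists>f. f n = 1 \<and> (\<forall>k>n. f k = 0) \<and>
      (\<forall>j<n. (\<Sum>k\<le>n. f k * ?m (k + j)) = 0) \<and>
      (\<Sum>k\<le>n. f k * ?m (k + n)) = q_jacobi_norm q a b n"
    using orthogonal_polynomial_exists by simp
  from choice[OF this] obtain f where f: "\<And>n. f n n = 1" "\<And>n k. n < k \<Longrightarrow> f n k = 0"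
    "\<And>n j. j < n \<Longrightarrow> (\<Sum>k\<le>n. f n k * ?m (k + j)) = 0"
    "\<And>n. (\<Sum>k\<le>n. f n k * ?m (k + n)) = q_jacobi_norm q a b n"
    by blast
  have "pfaffian N ?A = (\<Prod>k<N. - s (2 * k) * q_jacobi_norm q a b (2 * k + 1))"
  proof (rule pfaffian_two_term_hankel[OF _ two_term f])
    show "?A i j = - ?A j i" for i j
      by (simp only: add.commute[of j i] mult_minus_left[symmetric] minus_diff_eq)
  qed
  also have "\<dots> = (\<Prod>k<N. q_jacobi_norm q a b (Suc (2 * k)) * (1 - a * b * q ^ (4 * k)) /
      (a * q ^ (2 * k)) * ((1 - a * b) * (1 - a * b * q) / ((1 - a) * (1 - b))))"
  proof (rule prod.cong[OF refl])
    fix k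
    have "- (b * q ^ (2 * k) - 1 / (a * q ^ (2 * k))) = (1 - a * b * q ^ (4 * k)) / (a * q ^ (2 * k))"
      using a q by (simp add: field_simps power_add[symmetric])
    then have "- s (2 * k) = c * ((1 - a * b * q ^ (4 * k)) / (a * q ^ (2 * k)))"
      unfolding s_def mult_minus_right[symmetric] by (simp only:)
    then show "- s (2 * k) * q_jacobi_norm q a b (2 * k + 1) =
      q_jacobi_norm q a b (Suc (2 * k)) * (1 - a * b * q ^ (4 * k)) /
      (a * q ^ (2 * k)) * ((1 - a * b) * (1 - a * b * q) / ((1 - a) * (1 - b)))"
      by (simp add: c_def ac_simps)
  qed
  finally show ?thesis by (simp only: norm_odd)
qed

end

section \<open>Infinite q-Pochhammer symbols\<close>

lemma convergent_prod_q_poch: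
  fixes x q :: real
  assumes "0 < q" "q < 1"
  shows "convergent_prod (\<lambda>l. 1 - x * q ^ l)"
proof (rule abs_convergent_prod_imp_convergent_prod, rule summable_imp_abs_convergent_prod)
  have "summable (\<lambda>l. \<bar>x\<bar> * q ^ l)" using assms by (intro summable_mult summable_geometric) auto
  then show "summable (\<lambda>l. norm (1 - x * q ^ l - 1))" using assms by (simp add: abs_mult)
qed

lemma q_poch_inf_nz:
  assumes "0 < q" "q < 1" "0 < x" "x < 1"
  shows "q_poch_inf x q \<noteq> 0"
proof -
  have "1 - x * q ^ l \<noteq> 0" for l using mult_power_less_1[OF assms, of l] by simp
  then show ?thesis
    unfolding q_poch_inf_def
    using prodinf_nonzero[OF convergent_prod_q_poch[OF assms(1,2)]] by simp
qed

lemma q_poch_inf_split: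
  assumes "0 < q" "q < 1" "0 < x" "x < 1"
  shows "q_poch_inf x q = fin_q_poch x q n * q_poch_inf (x * q ^ n) q"
proof -
  have nz: "1 - x * q ^ l \<noteq> 0" for l using mult_power_less_1[OF assms, of l] by simp
  have "q_poch_inf x q = (\<Prod>l. 1 - x * q ^ (l + n)) * (\<Prod>l<n. 1 - x * q ^ l)"
    unfolding q_poch_inf_def
    by (rule prodinf_split_initial_segment[OF convergent_prod_q_poch[OF assms(1,2)] nz])
  then show ?thesis
    by (simp add: fin_q_poch_def q_poch_inf_def power_add mult_ac)
qed

lemma q_poch_of_nat:
  assumes "0 < q" "q < 1" "0 < x" "x < 1"
  shows "q_poch x q (real n) = fin_q_poch x q n"
proof -
  have "0 < x * q ^ n" "x * q ^ n < 1" using mult_power_less_1[OF assms, of n] assms by auto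
  then have "q_poch_inf (x * q ^ n) q \<noteq> 0" by (intro q_poch_inf_nz assms) auto
  then show ?thesis
    using q_poch_inf_split[OF assms, of n] assms by (simp add: q_poch_def powr_realpow)
qed

text \<open>Both infinite products are tails of the one starting at \<open>x\<close>. The case
  \<open>n = 0\<close> is the index -2 of the factor \<open>k = 0\<close>.\<close>

lemma q_poch_minus_2:
  assumes "0 < q" "q < 1" "0 < x" "x < 1"
  shows "q_poch (x * q ^ 2) q (real n - 2) = fin_q_poch x q n / ((1 - x) * (1 - x * q))"
proof -
  have "q powr (real n - 2) = q ^ n / q ^ 2"
    using assms by (simp add: powr_diff powr_realpow powr_numeral)
  then have "q ^ 2 * q powr (real n - 2) = q ^ n" using assms by simp
  then have "q_poch (x * q ^ 2) q (real n - 2) = q_poch_inf (x * q ^ 2) q / q_poch_inf (x * q ^ n) q"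
    by (simp add: q_poch_def mult.assoc)
  also have "\<dots> = q_poch_inf x q / q_poch_inf (x * q ^ n) q / fin_q_poch x q 2"
    using q_poch_inf_split[OF assms, of 2] fin_q_poch_pos[OF assms, of 2] by simp
  also have "q_poch_inf x q / q_poch_inf (x * q ^ n) q = fin_q_poch x q n"
    using q_poch_of_nat[OF assms, of n] assms by (simp add: q_poch_def powr_realpow)
  finally show ?thesis by (simp add: numeral_2_eq_2 fin_q_poch_Suc)
qed

text \<open>The exponents 2k(\<alpha>+1) + 4k^2 sum to N(N-1)(\<alpha>+1) +
  (2/3)N(N-1)(2N-1).\<close>

lemma prod_power_eq_powr:
  fixes q \<alpha> :: real
  assumes "0 < q"
  shows "(\<Prod>k<N. (q powr (\<alpha> + 1)) ^ (2 * k) * q ^ (4 * k ^ 2))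
       = q powr (1 / 3 * real N * (real N - 1) * (4 * real N + 1) + \<alpha> * real N * (real N - 1))"
proof (induction N)
  case 0
  then show ?case using assms by simp
next
  case (Suc N)
  have "(q powr (\<alpha> + 1)) ^ (2 * N) = q powr ((\<alpha> + 1) * real (2 * N))"
    using assms by (simp only: powr_realpow[symmetric] powr_powr powr_gt_zero)
  moreover have "q ^ (4 * N ^ 2) = q powr real (4 * N ^ 2)"
    using assms by (simp only: powr_realpow)
  ultimately have "(q powr (\<alpha> + 1)) ^ (2 * N) * q ^ (4 * N ^ 2)
      = q powr ((\<alpha> + 1) * (2 * real N) + 4 * real N ^ 2)"
    by (simp add: powr_add)
  then show ?case
    using Suc.IH by (simp add: powr_add[symmetric] field_simps power2_eq_square)
qed

section \<open>Translation to the parameters \<alpha> and \<beta>\<close>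

theorem mainTheorem4:
  fixes q \<alpha> \<beta> :: real and N :: nat
  assumes "0 < q" and "q < 1"
    and "N \<ge> 1"
    and "\<alpha> > -1" and "\<beta> > -1"
  shows "pfaffian N (\<lambda>i j. (q_bracket q j - q_bracket q i) *
             ((1 - q) * q_poch (q powr (\<alpha> + 2)) q (real i + real j - 1)
                / q_poch (q powr (\<alpha> + \<beta> + 4)) q (real i + real j - 1)))
       = q powr (1 / 3 * real N * (real N - 1) * (4 * real N + 1) + \<alpha> * real N * (real N - 1)) *
         (\<Prod>k = 0..N - 1.
            (q_poch q q (2 * real k + 1) * q_poch (q powr (\<alpha> + 2)) q (2 * real k)
               * q_poch (q powr (\<beta> + 2)) q (2 * real k))
            / (q_poch (q powr (\<alpha> + \<beta> + 4)) q (2 * real k - 2)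
               * q_poch (q powr (\<alpha> + \<beta> + 2 * real k + 2)) q (2 * real k)
               * q_poch (q powr (\<alpha> + \<beta> + 2 * real k + 2)) q (2 * real k + 2)))"
proof -
  define a where "a = q powr (\<alpha> + 1)"
  define b where "b = q powr (\<beta> + 1)"
  have less_1: "q powr x < 1" if "0 < x" for x
    using powr_less_mono'[of q 0 x] that assms by simp
  interpret q_jacobi q a b
    using assms less_1 by unfold_locales (auto simp: a_def b_def)
  interpret s: q_jacobi q "a * q" "b * q" by (rule q_jacobi_shift)
  have aq: "q powr (\<alpha> + 2) = a * q" and bq: "q powr (\<beta> + 2) = b * q"
    and abq2: "q powr (\<alpha> + \<beta> + 4) = a * b * q ^ 2"
    using assms powr_add[of q "\<alpha> + 1" 1] powr_add[of q "\<beta> + 1" 1]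
      powr_add[of q "\<alpha> + \<beta> + 2" 2] powr_add[of q "\<alpha> + 1" "\<beta> + 1"]
    by (simp_all add: a_def b_def powr_numeral add_ac)
  have abk: "q powr (\<alpha> + \<beta> + 2 * real k + 2) = a * b * q ^ (2 * k)" for k
  proof -
    have "q powr (\<alpha> + \<beta> + 2 * real k + 2) = q powr ((\<alpha> + 1) + (\<beta> + 1) + real (2 * k))"
      by (simp add: algebra_simps)
    then show ?thesis
      unfolding powr_add a_def b_def using assms powr_realpow[of q "2 * k"] by simp
  qed
  have abk_bounds: "0 < a * b * q ^ k" "a * b * q ^ k < 1" for k
    using mult_power_less_1[OF q ab] ab q by auto
  have entry: "(q_bracket q j - q_bracket q i) *
             ((1 - q) * q_poch (q powr (\<alpha> + 2)) q (real i + real j - 1)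
                / q_poch (q powr (\<alpha> + \<beta> + 4)) q (real i + real j - 1))
      = (q ^ i - q ^ j) * ((1 - a * b) * (1 - a * b * q) / (1 - a)) *
       (q_jacobi_moment q a b (i + j) / (1 - a * b * q ^ (i + j)))" for i j
  \<comment> \<open>For \<open>i + j = 0\<close> both sides vanish because \<open>i = j\<close>,
    whatever the symbols of index -1 are. Otherwise the quotient of symbols is a moment for (a q, b
    q), rewritten by \<open>moment_shift\<close>.\<close>
  proof (cases "i + j")
    case (Suc n)
    then have n: "real i + real j - 1 = real n" by linarith
    have "q_poch (q powr (\<alpha> + 2)) q (real n) = fin_q_poch (a * q) q n"
      unfolding aq using s.q s.a by (intro q_poch_of_nat) auto
    moreover have "q_poch (q powr (\<alpha> + \<beta> + 4)) q (real n) = fin_q_poch (a * q * (b * q)) q n"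
      unfolding abq2 using abk_bounds[of 2] q
      by (subst q_poch_of_nat) (auto simp: power2_eq_square ac_simps)
    ultimately have m: "q_poch (q powr (\<alpha> + 2)) q (real n) / q_poch (q powr (\<alpha> + \<beta> + 4)) q (real n)
        = q_jacobi_moment q (a * q) (b * q) n"
      by (simp add: q_jacobi_moment_def)
    have "(q_bracket q j - q_bracket q i) * (1 - q) = q ^ i - q ^ j"
      using q by (simp add: q_bracket_def diff_divide_distrib[symmetric])
    moreover have "(1 - a * b) * (1 - a * b * q) / (1 - a) *
        (q_jacobi_moment q a b (Suc n) / (1 - a * b * q ^ Suc n))
        = q_jacobi_moment q (a * q) (b * q) n"
      unfolding moment_shift using factor_nz by simp
    ultimately show ?thesis
      unfolding n Suc using m by (metis mult.assoc times_divide_eq_right)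
  qed simp
  \<comment> \<open>By \<open>q_poch_minus_2\<close> with \<open>x = a * b\<close>, the divided
    symbol is the one with index \<open>2 * real k - 2\<close>, including
    \<open>k = 0\<close>.\<close>
  have factor: "(fin_q_poch q q (2 * k + 1) * fin_q_poch (a * q) q (2 * k) * fin_q_poch (b * q) q (2 * k) /
       (fin_q_poch (a * b) q (2 * k) / ((1 - a * b) * (1 - a * b * q)) *
        fin_q_poch (a * b * q ^ (2 * k)) q (2 * k) *
        fin_q_poch (a * b * q ^ (2 * k)) q (2 * k + 2)))
      = (q_poch q q (2 * real k + 1) * q_poch (q powr (\<alpha> + 2)) q (2 * real k)
               * q_poch (q powr (\<beta> + 2)) q (2 * real k))
            / (q_poch (q powr (\<alpha> + \<beta> + 4)) q (2 * real k - 2)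
               * q_poch (q powr (\<alpha> + \<beta> + 2 * real k + 2)) q (2 * real k)
               * q_poch (q powr (\<alpha> + \<beta> + 2 * real k + 2)) q (2 * real k + 2))" for k
    using q_poch_of_nat[OF q q, of "2 * k + 1"] q_poch_of_nat[OF q s.a, of "2 * k"]
      q_poch_of_nat[OF q s.b, of "2 * k"] q_poch_minus_2[OF q ab, of "2 * k"]
      q_poch_of_nat[OF q abk_bounds[of "2 * k"], of "2 * k"]
      q_poch_of_nat[OF q abk_bounds[of "2 * k"], of "2 * k + 2"]
    unfolding aq bq abq2 abk by (simp add: add_ac)
  have range: "{0..N - 1} = {..<N}" using \<open>N \<ge> 1\<close> by auto
  show ?thesis
    unfolding entry range pfaffian_q_jacobi factor prod.distrib[where A = "{..<N}"]
    using prod_power_eq_powr[OF assms(1), of \<alpha> N] by (simp only: a_def[symmetric] prod.distrib)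
qed

end
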